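(* Let $M>0$ and let $f$ be a holomorphic function on $\mathbb{H}$ with $|f|<M$ on $\mathbb{H}$ which has an asymptotic expansion $\sum_{j=0}^\infty c_je^{-\lambda_jz}$. Then $|c_j|\le M$ for every $j\ge 0$.
   Context: $\mathbb{H}=\{z\in\mathbb{C}:\operatorname{Re}z>0\}$ is the right half-plane. Let $\lambda_0=0$ and let $\{\lambda_j\}_{j\ge1}$ be a strictly increasing sequence of positive numbers converging to infinity. A formal series $\sum_{j=0}^\infty c_je^{-\lambda_jz}$ with $c_j\in\mathbb{C}$ is called an asymptotic expansion of a holomorphic function $f$ on $\mathbb{H}$ if for every $n\ge0$ one has $\left|f(z)-\sum_{j=0}^nc_je^{-\lambda_jz}\right|e^{\lambda_n\operatorname{Re}z}\to0$ as $\operatorname{Re}z\to\infty$ (uniformly in $\operatorname{Im}z$). *)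

theory Defs
  imports "HOL-Analysis.Analysis"
begin

definition right_half_plane :: "complex set" where
  "right_half_plane = {z. Re z > 0}"

definition exponent_sequence :: "(nat \<Rightarrow> real) \<Rightarrow> bool" where
  "exponent_sequence lam \<longleftrightarrow>
     lam 0 = 0 \<and> (\<forall>j\<ge>1. lam j > 0) \<and> strict_mono_on {1..} lam \<and> filterlim lam at_top sequentially"

(* The limit is in x = Re z, uniformly over y = Im z in UNIV. Only values of f at points
   with large real part matter, so what f does outside the half-plane is irrelevant. *)
definition has_asymptotic_expansion ::
    "(nat \<Rightarrow> real) \<Rightarrow> (nat \<Rightarrow> complex) \<Rightarrow> (complex \<Rightarrow> complex) \<Rightarrow> bool" where
  "has_asymptotic_expansion lam c f \<longleftrightarrow>
     (\<forall>n. uniform_limit UNIV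
        (\<lambda>x y. norm (f (Complex x y)
                    - (\<Sum>j\<le>n. c j * exp (- complex_of_real (lam j) * Complex x y)))
               * exp (lam n * x))
        (\<lambda>y. 0) at_top)"

end

theory Submission
  imports Defs "HOL-Complex_Analysis.Cauchy_Integral_Theorem"
begin

text \<open>
  By Cauchy's theorem, the mean value of \<open>f(z) exp(\<lambda> z)\<close> over a vertical line in the half-plane does
  not depend on the line, since the horizontal sides of a long rectangle contribute a bounded amount.
  For \<open>\<lambda> = \<lambda>\<^sub>n\<close> this mean value tends to \<open>c\<^sub>n\<close> far to the right, and close to the imaginary axis it is
  at most M up to a factor close to 1. Integrals are replaced throughout by differences
  of primitives, which are estimated by the mean value inequality.
\<close>

lemma convex_Re_vimage:
  assumes "convex A"
  shows "convex {z. Re z \<in> A}"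
  using convex_linear_vimage[OF bounded_linear.linear[OF bounded_linear_Re] assms] by (simp add: vimage_def)

text \<open>This replaces dividing by \<open>T\<close> and letting \<open>T\<close> tend to
  infinity: all contributions that stay bounded in \<open>T\<close> are collected in
  \<open>B\<close> and disappear.\<close>

lemma linear_growth_le:
  fixes K A B :: real
  assumes "\<And>T. T > 0 \<Longrightarrow> K * T \<le> A * T + B"
  shows "K \<le> A"
proof (rule ccontr)
  assume "\<not> K \<le> A"
  \<comment> \<open>Chosen so that the excess \<open>(K - A) * T\<close> is larger than
    \<open>B\<close>.\<close>
  moreover define T where "T = (\<bar>B\<bar> + 1) / (K - A)"
  ultimately have "T > 0" and "(K - A) * T = \<bar>B\<bar> + 1"
    by auto
  with assms[of T] show False
    by (simp add: algebra_simps)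
qed

lemma exponent_sequence_less:
  assumes "exponent_sequence lam" and "j < n"
  shows "lam j < lam n"
  using assms unfolding exponent_sequence_def strict_mono_on_def
  by (cases j) auto

text \<open>The increment of \<open>F\<close> along the line at \<open>X\<close> is compared with
  the one at \<open>x\<close> via the two horizontal sides. The bound \<open>B\<close> is multiplied
  only by the fixed width \<open>X - x\<close>, never by \<open>T\<close>, so it may be crude; only
  \<open>A\<close> matters for large \<open>T\<close>.\<close>

lemma norm_vertical_mean_le:
  fixes F g :: "complex \<Rightarrow> complex"
  assumes F: "\<And>z. Re z > 0 \<Longrightarrow> (F has_field_derivative g z) (at z)"
    and x: "0 < x" "x \<le> X" and T: "T > 0"
    and strip: "\<And>z. x \<le> Re z \<Longrightarrow> Re z \<le> X \<Longrightarrow> norm (g z) \<le> B"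
    and line: "\<And>z. Re z = x \<Longrightarrow> norm (g z) \<le> A"
  shows "norm (F (Complex X T) - F (Complex X (-T))) \<le> 2 * T * A + 2 * (X - x) * B"
proof -
  have horizontal: "norm (F (Complex X t) - F (Complex x t)) \<le> B * (X - x)" for t
  proof -
    have "norm (F (Complex X t) - F (Complex x t)) \<le> B * norm (Complex X t - Complex x t)"
      by (rule field_differentiable_bound[OF convex_Re_vimage[OF convex_real_interval(5)[of x X]],
            where f' = g])
         (use x strip in \<open>auto intro: has_field_derivative_at_within[OF F]\<close>)
    also have "norm (Complex X t - Complex x t) = X - x"
      using x by (simp add: cmod_def)
    finally show ?thesis .
  qed
  \<comment> \<open>The convex set is now the line alone, so the sharper bound \<open>A\<close>
    applies.\<close>
  have "norm (F (Complex x T) - F (Complex x (-T))) \<le> A * norm (Complex x T - Complex x (-T))"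
    by (rule field_differentiable_bound[OF convex_Re_vimage[OF convex_singleton[of x]],
          where f' = g])
       (use x line in \<open>auto intro: has_field_derivative_at_within[OF F]\<close>)
  also have "norm (Complex x T - Complex x (-T)) = 2 * T"
    using T by (simp add: cmod_def real_sqrt_mult)
  finally have vertical: "norm (F (Complex x T) - F (Complex x (-T))) \<le> A * (2 * T)" .
  have "norm (p - q) \<le> h + v + h"
    if "norm (p - p') \<le> h" "norm (p' - q') \<le> v" "norm (q - q') \<le> h"
    for p q p' q' :: complex and h v
    using that by norm
  from this[OF horizontal vertical horizontal]
  have "norm (F (Complex X T) - F (Complex X (-T))) \<le> B * (X - x) + A * (2 * T) + B * (X - x)" .
  then show ?thesis
    by (simp add: algebra_simps)
qed

text \<open>A primitive of the exponential sum is again an exponential sum, as no \<open>a j\<close>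
  vanishes, and it is bounded on a vertical line because the \<open>a j\<close> are real. Hence only
  the constant \<open>C\<close> and the error \<open>e\<close> contribute terms that grow with
  \<open>T\<close>.\<close>

lemma norm_coefficient_le_vertical_mean:
  fixes F g :: "complex \<Rightarrow> complex" and a :: "nat \<Rightarrow> real"
  assumes F: "\<And>z. Re z = X \<Longrightarrow> (F has_field_derivative g z) (at z)"
    and a: "\<And>j. j < n \<Longrightarrow> a j \<noteq> 0"
    and T: "T > 0"
    and close: "\<And>z. Re z = X \<Longrightarrow>
      norm (g z - (C + (\<Sum>j<n. c j * exp (complex_of_real (a j) * z)))) \<le> e"
  shows "norm C * (2 * T) \<le> norm (F (Complex X T) - F (Complex X (-T))) + 2 * T * e
    + 2 * (\<Sum>j<n. norm (c j) * exp (a j * X) / \<bar>a j\<bar>)"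
proof -
  define S where "S z = (\<Sum>j<n. c j * exp (complex_of_real (a j) * z) / complex_of_real (a j))" for z
  \<comment> \<open>\<open>D\<close> is a primitive of the approximation error, so its derivative on
    the line is at most \<open>e\<close> in norm.\<close>
  define D where "D z = F z - C * z - S z" for z
  define R where "R = (\<Sum>j<n. norm (c j) * exp (a j * X) / \<bar>a j\<bar>)"
  have S': "(S has_field_derivative (\<Sum>j<n. c j * exp (complex_of_real (a j) * z))) (at z)" for z
    unfolding S_def
    by (rule DERIV_sum) (use a in \<open>auto intro!: derivative_eq_intros\<close>)
  have D': "(D has_field_derivative
      g z - (C + (\<Sum>j<n. c j * exp (complex_of_real (a j) * z)))) (at z)" if "Re z = X" for z
    unfolding D_def
    using DERIV_diff[OF DERIV_diff[OF F[OF that] DERIV_cmult_Id] S'] by (simp add: diff_diff_eq)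
  have "norm (D (Complex X T) - D (Complex X (-T))) \<le> e * norm (Complex X T - Complex X (-T))"
    by (rule field_differentiable_bound[OF convex_Re_vimage[OF convex_singleton[of X]],
          where f' = "\<lambda>z. g z - (C + (\<Sum>j<n. c j * exp (complex_of_real (a j) * z)))"])
       (use close in \<open>auto intro: has_field_derivative_at_within[OF D']\<close>)
  also have "norm (Complex X T - Complex X (-T)) = 2 * T"
    using T by (simp add: cmod_def real_sqrt_mult)
  finally have D_le: "norm (D (Complex X T) - D (Complex X (-T))) \<le> e * (2 * T)" .
  have S_le: "norm (S (Complex X t)) \<le> R" for t
    unfolding S_def R_def
    by (rule sum_norm_le) (simp add: norm_mult norm_divide)
  have "C * (Complex X T - Complex X (-T)) =
      (F (Complex X T) - F (Complex X (-T))) - (D (Complex X T) - D (Complex X (-T)))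
      - (S (Complex X T) - S (Complex X (-T)))"
    unfolding D_def by (simp add: algebra_simps)
  also have "norm \<dots> \<le> norm (F (Complex X T) - F (Complex X (-T))) + e * (2 * T) + (R + R)"
    using D_le S_le[of T] S_le[of "-T"] by norm
  finally have "norm C * norm (Complex X T - Complex X (-T)) \<le>
      norm (F (Complex X T) - F (Complex X (-T))) + e * (2 * T) + (R + R)"
    by (simp add: norm_mult)
  also have "norm (Complex X T - Complex X (-T)) = 2 * T"
    using T by (simp add: cmod_def real_sqrt_mult)
  finally show ?thesis
    by (simp add: R_def algebra_simps)
qed

text \<open>The weight \<open>exp (lam n * X)\<close> is the modulus of
  \<open>exp (lam n * z)\<close> on the line, so it can be absorbed as a holomorphic factor. This
  turns the term with \<open>j = n\<close> into the constant \<open>c n\<close>.\<close>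

lemma has_asymptotic_expansion_scaled:
  assumes "has_asymptotic_expansion lam c f" and "e > 0"
  shows "\<forall>\<^sub>F X in at_top. \<forall>z. Re z = X \<longrightarrow>
    norm (f z * exp (complex_of_real (lam n) * z)
      - (c n + (\<Sum>j<n. c j * exp (complex_of_real (lam n - lam j) * z)))) \<le> e"
proof -
  have "\<forall>\<^sub>F X in at_top. \<forall>y\<in>UNIV. dist (norm (f (Complex X y)
        - (\<Sum>j\<le>n. c j * exp (- complex_of_real (lam j) * Complex X y))) * exp (lam n * X)) 0 < e"
    using assms unfolding has_asymptotic_expansion_def uniform_limit_iff by blast
  then show ?thesis
  proof eventually_elim
    case (elim X)
    show ?case
    proof (intro allI impI)
      fix z assume z: "Re z = X"
      let ?E = "exp (complex_of_real (lam n) * z)"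
      have "c n + (\<Sum>j<n. c j * exp (complex_of_real (lam n - lam j) * z))
          = (\<Sum>j\<le>n. c j * exp (complex_of_real (lam n - lam j) * z))"
        by (simp add: lessThan_Suc_atMost[symmetric])
      also have "\<dots> = (\<Sum>j\<le>n. c j * exp (- complex_of_real (lam j) * z)) * ?E"
        unfolding sum_distrib_right
        by (rule sum.cong) (simp_all add: exp_add[symmetric] algebra_simps)
      finally have "norm (f z * ?E - (c n + (\<Sum>j<n. c j * exp (complex_of_real (lam n - lam j) * z))))
          = norm (f z - (\<Sum>j\<le>n. c j * exp (- complex_of_real (lam j) * z))) * norm ?E"
        by (simp only: norm_mult[symmetric] left_diff_distrib)
      also have "\<dots> \<le> e"
        using elim[rule_format, of "Im z"] z by (auto simp: abs_mult)
      finally show "norm (f z * ?E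
          - (c n + (\<Sum>j<n. c j * exp (complex_of_real (lam n - lam j) * z)))) \<le> e" .
    qed
  qed
qed

lemma norm_coefficient_le_exp:
  assumes lam: "exponent_sequence lam"
    and holo: "f holomorphic_on right_half_plane"
    and bound: "\<And>z. z \<in> right_half_plane \<Longrightarrow> norm (f z) \<le> M"
    and exp: "has_asymptotic_expansion lam c f"
    and x: "x > 0" and e: "e > 0"
  shows "norm (c n) \<le> M * exp (lam n * x) + e"
proof -
  define g where "g z = f z * exp (complex_of_real (lam n) * z)" for z
  have lam_nonneg: "lam n \<ge> 0"
    using lam unfolding exponent_sequence_def by (cases n) (auto simp: less_imp_le)
  have M: "M \<ge> 0"
    using order_trans[OF norm_ge_zero bound[of 1]] by (simp add: right_half_plane_def)
  have open_H: "open right_half_plane" and convex_H: "convex right_half_plane"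
    by (simp_all add: right_half_plane_def open_halfspace_Re_gt convex_halfspace_Re_gt)
  have "g holomorphic_on right_half_plane"
    unfolding g_def by (intro holomorphic_intros holo)
  \<comment> \<open>The primitive exists by Cauchy's theorem on the convex half-plane.\<close>
  then obtain F where F: "\<And>z. Re z > 0 \<Longrightarrow> (F has_field_derivative g z) (at z)"
    using holomorphic_convex_primitive'[OF convex_H open_H, of g]
    by (auto simp: right_half_plane_def at_within_open[OF _ open_H[unfolded right_half_plane_def]])
  \<comment> \<open>Used with \<open>r = x\<close> on the left line and with \<open>r = X\<close> on
    the whole strip.\<close>
  have g_le: "norm (g z) \<le> M * exp (lam n * r)" if "0 < Re z" "Re z \<le> r" for z r
    unfolding g_def norm_mult
    using that bound[of z] M lam_nonneg
    by (intro mult_mono) (auto simp: right_half_plane_def mult_left_mono)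
  \<comment> \<open>\<open>X\<close> depends on \<open>e\<close> but not on \<open>T\<close>, so it
    stays fixed while \<open>T\<close> grows.\<close>
  obtain X where X: "X \<ge> x"
    and close: "\<And>z. Re z = X \<Longrightarrow>
      norm (g z - (c n + (\<Sum>j<n. c j * exp (complex_of_real (lam n - lam j) * z)))) \<le> e"
    using eventually_happens[OF eventually_conj[OF
          has_asymptotic_expansion_scaled[OF exp e, of n] eventually_ge_at_top[of x]]]
    unfolding g_def by auto
  have distinct: "lam n - lam j \<noteq> 0" if "j < n" for j
    using exponent_sequence_less[OF lam that] by simp
  define R where "R = (\<Sum>j<n. norm (c j) * exp ((lam n - lam j) * X) / \<bar>lam n - lam j\<bar>)"
  show ?thesis
  proof (rule linear_growth_le)
    fix T :: real assume T: "T > 0"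
    have "norm (c n) * (2 * T) \<le>
        norm (F (Complex X T) - F (Complex X (-T))) + 2 * T * e + 2 * R"
      unfolding R_def
      by (rule norm_coefficient_le_vertical_mean[where g = g and c = c and a = "\<lambda>j. lam n - lam j"])
         (use F x X distinct T close in simp_all)
    moreover have "norm (F (Complex X T) - F (Complex X (-T))) \<le>
        2 * T * (M * exp (lam n * x)) + 2 * (X - x) * (M * exp (lam n * X))"
      by (rule norm_vertical_mean_le[OF F x X T]) (use x g_le in auto)
    ultimately show "norm (c n) * T \<le>
        (M * exp (lam n * x) + e) * T + ((X - x) * (M * exp (lam n * X)) + R)"
      by (simp add: algebra_simps)
  qed
qed

theorem theorem3p5:
  fixes M :: real and f :: "complex \<Rightarrow> complex"
    and lam :: "nat \<Rightarrow> real" and c :: "nat \<Rightarrow> complex"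
  assumes "exponent_sequence lam"
    and "M > 0"
    and "f holomorphic_on right_half_plane"
    and "\<And>z. z \<in> right_half_plane \<Longrightarrow> norm (f z) < M"
    and "has_asymptotic_expansion lam c f"
  shows "\<forall>j. norm (c j) \<le> M"
proof
  fix j
  \<comment> \<open>The abscissa of the left line also serves as the error \<open>e\<close>, so a
    single limit \<open>x\<close> to 0 from the right removes both.\<close>
  have "norm (c j) \<le> M * exp (lam j * x) + x" if "x > 0" for x
    using norm_coefficient_le_exp[OF assms(1,3) less_imp_le[OF assms(4)] assms(5) that that] .
  then have "\<forall>\<^sub>F x in at_right 0. norm (c j) \<le> M * exp (lam j * x) + x"
    by (auto simp: eventually_at_right_less intro: eventually_at_rightI[of 0 1])
  moreover have "((\<lambda>x. M * exp (lam j * x) + x) \<longlongrightarrow> M * exp (lam j * 0) + 0) (at_right 0)"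
    by (intro tendsto_intros)
  ultimately have "norm (c j) \<le> M * exp (lam j * 0) + 0"
    by (intro tendsto_lowerbound) auto
  then show "norm (c j) \<le> M"
    by simp
qed

end
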